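(* Let $n\ge 1$ be an integer and let $G$ and $H$ be misère impartial games that are both even. If $n\cdot G = n\cdot H$, then $G=H$.
   Context: A (misère impartial) game is a hereditarily finite set; its elements are called its options. $0=\{\}$, $1=\{0\}$. The sum is $G+H=\{G'+H: G'\in G\}\cup\{G+H':H'\in H\}$, and $n\cdot G$ is the sum of $n$ copies of $G$. Misère outcome: $G$ is a $\mathscr{P}$-position if $G$ is nonempty and every option of $G$ is an $\mathscr{N}$-position; otherwise $G$ is an $\mathscr{N}$-position. $G=H$ means that $G+X$ and $H+X$ have the same misère outcome for every game $X$. An option $G'$ of $G$ is reversible if $G'$ has an option $G''$ with $G''=G$. $G$ is in simplest form if it has no reversible options; every game is equal to one in simplest form, whose options are determined up to equality. $G$ is even if $G$ is equal to an option of the simplest form of $G+1$; in that case $G+1$ is called odd. *)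

theory Defs
  imports Main "HOL-Library.FSet"
begin

text \<open>Games are hereditarily finite sets: \<open>game\<close> is the least solution of
  \<open>game = game fset\<close>, so two games with the same options are identical.\<close>

datatype game = Game (options: "game fset")

lemma size_option: "H |\<in>| options G \<Longrightarrow> size H < size G"
proof (cases G)
  case (Game A)
  assume "H |\<in>| options G"
  with Game have "H \<in> fset A" by simp
  then have "Suc (size H) \<le> (\<Sum>x\<in>fset A. Suc (size x))"
    by (intro member_le_sum) auto
  with Game show ?thesis by simp
qed

lemma game_induct [case_names game]:
  "(\<And>G. (\<And>G'. G' |\<in>| options G \<Longrightarrow> P G') \<Longrightarrow> P G) \<Longrightarrow> P G"
  by (induction G rule: measure_induct_rule[where f = size]) (use size_option in blast)

declare fset.map_cong [fundef_cong]

function game_add :: "game \<Rightarrow> game \<Rightarrow> game" where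
  "game_add G H =
    Game ((\<lambda>G'. game_add G' H) |`| options G |\<union>| (\<lambda>H'. game_add G H') |`| options H)"
  by pat_completeness auto
termination
  by (relation "measure (\<lambda>(G, H). size G + size H)") (auto dest: size_option)

declare game_add.simps [simp del]

instantiation game :: comm_monoid_add
begin

definition zero_game :: game where
  "0 = Game {||}"

definition plus_game :: "game \<Rightarrow> game \<Rightarrow> game" where
  "G + H = game_add G H"

lemma options_add:
  "options (G + H) = (\<lambda>G'. G' + H) |`| options G |\<union>| (\<lambda>H'. G + H') |`| options H"
  for G H :: game
  unfolding plus_game_def by (subst game_add.simps) simp

instance
proof
  fix a b c :: game
  show "a + b + c = a + (b + c)"
  proof (induction "size a + size b + size c" arbitrary: a b c rule: less_induct)
    case less
    have 1: "a' + b + c = a' + (b + c)" if "a' |\<in>| options a" for a'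
      by (rule less) (use size_option[OF that] in simp)
    have 2: "a + b' + c = a + (b' + c)" if "b' |\<in>| options b" for b'
      by (rule less) (use size_option[OF that] in simp)
    have 3: "a + b + c' = a + (b + c')" if "c' |\<in>| options c" for c'
      by (rule less) (use size_option[OF that] in simp)
    show ?case
      by (rule game.expand, simp only: options_add fimage_funion fset.map_comp comp_def
            funion_assoc 1 2 3 cong: fset.map_cong)
  qed
  show "a + b = b + a"
  proof (induction "size a + size b" arbitrary: a b rule: less_induct)
    case less
    have 1: "a' + b = b + a'" if "a' |\<in>| options a" for a'
      by (rule less) (use size_option[OF that] in simp)
    have 2: "a + b' = b' + a" if "b' |\<in>| options b" for b'
      by (rule less) (use size_option[OF that] in simp)
    show ?case
      by (rule game.expand, simp only: options_add 1 2 funion_commute cong: fset.map_cong)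
  qed
  show "0 + a = a"
  proof (induction a rule: game_induct)
    case (game a)
    have "(\<lambda>x. 0 + x) |`| options a = (\<lambda>x. x) |`| options a"
      by (intro fset.map_cong refl) (rule game)
    then show ?case
      by (intro game.expand) (simp add: options_add, simp add: zero_game_def)
  qed
qed

end

instantiation game :: one
begin

definition one_game :: game where
  "1 = Game {|0|}"

instance ..

end

primrec copies :: "nat \<Rightarrow> game \<Rightarrow> game"  (infixr "\<cdot>" 75) where
  "0 \<cdot> G = 0"
| "Suc n \<cdot> G = G + n \<cdot> G"

lemma one_copy: "1 \<cdot> G = G"
  by simp

function is_P :: "game \<Rightarrow> bool" where
  "is_P G \<longleftrightarrow> options G \<noteq> {||} \<and> (\<forall>G' |\<in>| options G. \<not> is_P G')"
  by pat_completeness auto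
termination
  by (relation "measure size") (auto dest: size_option)

declare is_P.simps [simp del]

text \<open>There are only two outcomes, so equality of outcomes is equivalence of \<open>is_P\<close>.
  Equality of games in the misere sense is written \<open>\<approx>\<close>; HOL equality on \<open>game\<close>
  is identity of hereditarily finite sets.\<close>

definition game_eq :: "game \<Rightarrow> game \<Rightarrow> bool"  (infix "\<approx>" 50) where
  "G \<approx> H \<longleftrightarrow> (\<forall>X. is_P (G + X) \<longleftrightarrow> is_P (H + X))"

definition reversible :: "game \<Rightarrow> game \<Rightarrow> bool" where
  "reversible G G' \<longleftrightarrow> G' |\<in>| options G \<and> (\<exists>G'' |\<in>| options G'. G'' \<approx> G)"

definition simplest :: "game \<Rightarrow> bool" where
  "simplest G \<longleftrightarrow> (\<nexists>G'. reversible G G')"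

definition simplest_form_of :: "game \<Rightarrow> game \<Rightarrow> bool" where
  "simplest_form_of S G \<longleftrightarrow> simplest S \<and> S \<approx> G"

lemma simplest_form_exists: "\<exists>S. simplest_form_of S G"
proof -
  obtain S where S: "S \<approx> G" and min: "\<And>T. T \<approx> G \<Longrightarrow> size S \<le> size T"
    using ex_has_least_nat[of "\<lambda>S. S \<approx> G" G size] by (auto simp: game_eq_def)
  have "\<not> reversible S S'" for S'
  proof
    assume "reversible S S'"
    then obtain S'' where *: "S' |\<in>| options S" "S'' |\<in>| options S'" "S'' \<approx> S"
      by (auto simp: reversible_def)
    then have "size S'' < size S"
      using size_option by (meson less_trans)
    moreover have "S'' \<approx> G"
      using *(3) S by (auto simp: game_eq_def)
    ultimately show False
      using min by (meson leD)
  qed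
  with S show ?thesis
    by (auto simp: simplest_form_of_def simplest_def)
qed

text \<open>A simplest form is unique only up to \<open>\<approx>\<close> of its options, so ``the simplest form of
  \<open>G + 1\<close>'' is rendered by quantifying over simplest forms; which one is used does not matter
  because membership of \<open>G\<close> among its options is also taken up to \<open>\<approx>\<close>.\<close>

definition even_game :: "game \<Rightarrow> bool" where
  "even_game G \<longleftrightarrow> (\<exists>S. simplest_form_of S (G + 1) \<and> (\<exists>S' |\<in>| options S. G \<approx> S'))"

end

theory Submission
  imports Defs
begin

text \<open>Why even games have no torsion. Every option of the simplest form of \<open>n \<cdot> G = n \<cdot> H\<close>
  is equal both to some \<open>G' + (n - 1) \<cdot> G\<close> and to some \<open>H' + (n - 1) \<cdot> H\<close>. Taken
  \<open>n\<close> times, this equality reduces by cancellation to \<open>n \<cdot> G' = n \<cdot> H'\<close>, and by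
  induction \<open>G'\<close> and \<open>H'\<close> differ by at most a summand \<open>1\<close>. Returning to the equality
  itself, \<open>G\<close> and \<open>H\<close> differ by at most a summand \<open>1\<close>; if both are even, they are
  equal. If the simplest form has no options, then \<open>n \<cdot> G = n \<cdot> H = 0\<close>, and the only games
  with a positive multiple equal to \<open>0\<close> are \<open>0\<close> and \<open>1\<close>
  (\<open>copies_eq_zero\<close>), of which only \<open>0\<close> is even. The induction is carried out in
  \<open>even_torsion_free\<close>.

  The argument rests on Conway's cancellation theorem (\<open>add_left_cancel_eq\<close>). A game
  \<open>T\<close> has no inverse in general, but it has approximate ones: for every finite set of games
  there is an \<open>S\<close> such that adding \<open>T + S\<close> changes the outcome of none of them
  (\<open>approx_invertible\<close>), and this is enough to cancel \<open>T\<close>. The options of \<open>S\<close> come from a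
  separation lemma: if \<open>A\<close> differs from each of finitely many games, some \<open>R\<close> makes
  \<open>A + R\<close> a \<open>\<P>\<close>-position and all the other sums \<open>\<N>\<close>-positions (\<open>separation\<close>). The
  inequalities that separation requires are obtained by induction over \<open>T\<close>, one of them
  with a pigeonhole argument on the options of \<open>T\<close> (\<open>add_eq_self\<close>).

  Options of equal games are compared by means of Conway's linking theorem
  (\<open>linked_if_no_option_eq\<close>): an option of a game is never linked to that game, hence it is
  reversible or equal to an option of any other form of it.\<close>

section \<open>Outcomes and equality\<close>

lemma option_add_left: "G' |\<in>| options G \<Longrightarrow> G' + H |\<in>| options (G + H)"
  by (auto simp: options_add)

lemma option_add_right: "H' |\<in>| options H \<Longrightarrow> G + H' |\<in>| options (G + H)"
  by (auto simp: options_add)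

lemma option_addE:
  assumes "X |\<in>| options (G + H)"
  obtains (left) G' where "G' |\<in>| options G" "X = G' + H"
    | (right) H' where "H' |\<in>| options H" "X = G + H'"
  using assms by (auto simp: options_add)

lemma no_options_iff: "options G = {||} \<longleftrightarrow> G = 0"
  by (cases G) (simp add: zero_game_def)

lemma options_zero [simp]: "options 0 = {||}"
  by (simp add: no_options_iff)

lemma options_one [simp]: "options 1 = {|0|}"
  by (simp add: one_game_def)

lemma is_P_D: "is_P G \<Longrightarrow> G' |\<in>| options G \<Longrightarrow> \<not> is_P G'"
  by (subst (asm) is_P.simps) auto

lemma is_P_I: "X |\<in>| options G \<Longrightarrow> (\<And>G'. G' |\<in>| options G \<Longrightarrow> \<not> is_P G') \<Longrightarrow> is_P G"
  by (subst is_P.simps) auto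

lemma not_is_P_E:
  assumes "\<not> is_P G" "G \<noteq> 0"
  obtains G' where "G' |\<in>| options G" "is_P G'"
  using assms is_P.simps[of G] no_options_iff[of G] by auto

lemma not_is_P_zero [simp]: "\<not> is_P 0"
  by (subst is_P.simps) simp

lemma is_P_one [simp]: "is_P 1"
  by (rule is_P_I[of 0]) auto

lemma game_eq_refl [simp]: "G \<approx> G"
  by (simp add: game_eq_def)

lemma game_eq_sym: "G \<approx> H \<Longrightarrow> H \<approx> G"
  by (simp add: game_eq_def)

lemma game_eq_trans [trans]: "G \<approx> H \<Longrightarrow> H \<approx> K \<Longrightarrow> G \<approx> K"
  by (simp add: game_eq_def)

lemma game_eq_is_P: "G \<approx> H \<Longrightarrow> is_P G \<longleftrightarrow> is_P H"
  unfolding game_eq_def by (metis add.right_neutral)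

lemma game_eq_add_right: "G \<approx> H \<Longrightarrow> G + K \<approx> H + K"
  by (simp add: game_eq_def add.assoc)

lemma game_eq_add_left: "G \<approx> H \<Longrightarrow> K + G \<approx> K + H"
  using game_eq_add_right[of G H K] by (simp add: add.commute)

lemma game_eq_add: "G \<approx> H \<Longrightarrow> K \<approx> L \<Longrightarrow> G + K \<approx> H + L"
  by (blast intro: game_eq_add_left game_eq_add_right game_eq_trans)

lemma game_of_option_set:
  assumes "finite A"
  obtains G where "\<And>X. X |\<in>| options G \<longleftrightarrow> X \<in> A"
  using assms that[of "Game (Abs_fset A)"] by (simp add: Abs_fset_inverse)

section \<open>Separating and linking games\<close>

text \<open>The options of a mate of \<open>G\<close> are mates of the options of \<open>G\<close>, so that every
  move in the sum can be answered by restoring a pair of mates; \<open>1\<close> is a mate of \<open>0\<close>.\<close>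

lemma mate_exists: "\<exists>M. is_P (G + M)"
proof (induction G rule: game_induct)
  case (game G)
  then obtain m where m: "\<And>G'. G' |\<in>| options G \<Longrightarrow> is_P (G' + m G')"
    by metis
  show ?case
  proof (cases "G = 0")
    case True
    then show ?thesis by (intro exI[of _ 1]) simp
  next
    case False
    obtain M where M: "\<And>X. X |\<in>| options M \<longleftrightarrow> X \<in> m ` fset (options G)"
      using game_of_option_set[of "m ` fset (options G)"] by auto
    obtain G' where "G' |\<in>| options G"
      using False no_options_iff[of G] by auto
    then have "is_P (G + M)"
    proof (rule is_P_I[OF option_add_left])
      fix X assume "X |\<in>| options (G + M)"
      then show "\<not> is_P X"
      proof (cases rule: option_addE)
        case (left G')
        then show ?thesis
          using is_P_D[of X "G' + m G'"] m M option_add_right[of "m G'" M G'] by auto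
      next
        case (right M')
        then obtain G' where "G' |\<in>| options G" "M' = m G'" using M by auto
        then show ?thesis
          using right is_P_D[of X "G' + m G'"] m option_add_left[of G' G "m G'"] by auto
      qed
    qed
    then show ?thesis ..
  qed
qed

text \<open>Each \<open>B + R\<close> is an \<open>\<N>\<close>-position when \<open>R\<close> offers a winning move \<open>r B\<close> that does not
  win in \<open>A + R\<close>. Mates of the options of \<open>A\<close>, added as further options of \<open>R\<close>, answer
  the moves in \<open>A\<close>. The options of \<open>A + R\<close> are then all \<open>\<N>\<close>-positions, and there is at
  least one.\<close>

lemma separation_step:
  assumes "finite \<B>" and r: "\<And>B. B \<in> \<B> \<Longrightarrow> is_P (B + r B) \<and> \<not> is_P (A + r B)"
    and ne: "A \<noteq> 0 \<or> \<B> \<noteq> {}"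
  shows "\<exists>R. is_P (A + R) \<and> (\<forall>B\<in>\<B>. \<not> is_P (B + R))"
proof -
  obtain m where m: "\<And>G. is_P (G + m G)" using mate_exists by metis
  obtain R where R: "\<And>X. X |\<in>| options R \<longleftrightarrow> X \<in> r ` \<B> \<union> m ` fset (options A)"
    using game_of_option_set[of "r ` \<B> \<union> m ` fset (options A)"] assms(1) by auto
  have "R \<noteq> 0"
    using ne R no_options_iff[of A] by fastforce
  then obtain R' where "R' |\<in>| options R" using no_options_iff[of R] by auto
  then have "is_P (A + R)"
  proof (rule is_P_I[OF option_add_right])
    fix X assume "X |\<in>| options (A + R)"
    then show "\<not> is_P X"
    proof (cases rule: option_addE)
      case (left A')
      then show ?thesis
        using is_P_D[of X "A' + m A'"] m R option_add_right[of "m A'" R A'] by auto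
    next
      case (right R')
      then consider B where "B \<in> \<B>" "R' = r B" | A' where "A' |\<in>| options A" "R' = m A'"
        using R by auto
      then show ?thesis
        using right r is_P_D[of X] m option_add_left by (cases; metis)
    qed
  qed
  moreover have "\<not> is_P (B + R)" if "B \<in> \<B>" for B
    using that r R is_P_D[of "B + R" "B + r B"] option_add_right[of "r B" R B] by auto
  ultimately show ?thesis by blast
qed

text \<open>Inequality means that some \<open>X\<close> gives different outcomes; if it makes the wrong one of
  the two games a \<open>\<P>\<close>-position, one separation step reverses the roles.\<close>

lemma directed_separation:
  assumes "\<not> A \<approx> B"
  shows "\<exists>R. is_P (A + R) \<and> \<not> is_P (B + R)"
proof (rule ccontr)
  assume neg: "\<not> ?thesis"
  then obtain X where "is_P (B + X)" "\<not> is_P (A + X)"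
    using assms by (auto simp: game_eq_def)
  then show False
    using separation_step[of "{B}" "\<lambda>_. X" A] neg by auto
qed

lemma separation:
  assumes "finite \<B>" and "\<And>B. B \<in> \<B> \<Longrightarrow> \<not> A \<approx> B"
  shows "\<exists>R. is_P (A + R) \<and> (\<forall>B\<in>\<B>. \<not> is_P (B + R))"
proof (cases "\<B> = {}")
  case True
  then show ?thesis using mate_exists by auto
next
  case False
  have "\<exists>R. is_P (B + R) \<and> \<not> is_P (A + R)" if "B \<in> \<B>" for B
    using directed_separation[of B A] assms(2)[OF that] game_eq_sym by blast
  then obtain r where "\<And>B. B \<in> \<B> \<Longrightarrow> is_P (B + r B) \<and> \<not> is_P (A + r B)" by metis
  then show ?thesis using separation_step[of \<B> r A] assms(1) False by blast
qed

text \<open>Conway's linking theorem. If no option of either game equals the other game, each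
  option can be separated from the opposite game, and the separating games together are the
  options of a game \<open>R\<close> that makes both sums \<open>\<P>\<close>-positions.\<close>

definition linked :: "game \<Rightarrow> game \<Rightarrow> bool" where
  "linked G H \<longleftrightarrow> (\<exists>R. is_P (G + R) \<and> is_P (H + R))"

lemma linked_if_no_option_eq:
  assumes G: "\<And>G'. G' |\<in>| options G \<Longrightarrow> \<not> G' \<approx> H"
    and H: "\<And>H'. H' |\<in>| options H \<Longrightarrow> \<not> H' \<approx> G"
  shows "linked G H"
proof (cases "G = 0 \<and> H = 0")
  case True
  then show ?thesis unfolding linked_def by (intro exI[of _ 1]) simp
next
  case False
  obtain g where g: "\<And>G'. G' |\<in>| options G \<Longrightarrow> is_P (G' + g G') \<and> \<not> is_P (H + g G')"
    using directed_separation[OF G] by metis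
  obtain h where h: "\<And>H'. H' |\<in>| options H \<Longrightarrow> is_P (H' + h H') \<and> \<not> is_P (G + h H')"
    using directed_separation[OF H] by metis
  obtain R where R: "\<And>X. X |\<in>| options R \<longleftrightarrow> X \<in> g ` fset (options G) \<union> h ` fset (options H)"
    using game_of_option_set[of "g ` fset (options G) \<union> h ` fset (options H)"] by auto
  have "R \<noteq> 0"
    using False R no_options_iff[of G] no_options_iff[of H] by fastforce
  then obtain R' where R': "R' |\<in>| options R" using no_options_iff[of R] by auto
  have R_G: "\<not> is_P (G + X)" and R_H: "\<not> is_P (H + X)" if X: "X |\<in>| options R" for X
  proof -
    consider G' where "G' |\<in>| options G" "X = g G'" | H' where "H' |\<in>| options H" "X = h H'"
      using R X by auto
    then show "\<not> is_P (G + X)" "\<not> is_P (H + X)"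
      using g h is_P_D option_add_left by (cases; metis)+
  qed
  have "is_P (G + R)"
  proof (rule is_P_I[OF option_add_right[OF R']])
    fix X assume "X |\<in>| options (G + R)"
    then show "\<not> is_P X"
    proof (cases rule: option_addE)
      case (left G')
      then show ?thesis
        using is_P_D[of X "G' + g G'"] g R option_add_right[of "g G'" R G'] by auto
    qed (use R_G in auto)
  qed
  moreover have "is_P (H + R)"
  proof (rule is_P_I[OF option_add_right[OF R']])
    fix X assume "X |\<in>| options (H + R)"
    then show "\<not> is_P X"
    proof (cases rule: option_addE)
      case (left H')
      then show ?thesis
        using is_P_D[of X "H' + h H'"] h R option_add_right[of "h H'" R H'] by auto
    qed (use R_H in auto)
  qed
  ultimately show ?thesis unfolding linked_def by blast
qed

lemma option_not_linked: "G' |\<in>| options G \<Longrightarrow> G \<approx> H \<Longrightarrow> \<not> linked G' H"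
  unfolding linked_def game_eq_def using is_P_D option_add_left by blast

lemma option_not_eq: "G' |\<in>| options G \<Longrightarrow> \<not> G' \<approx> G"
  using option_not_linked[of G' G G'] mate_exists game_eq_sym unfolding linked_def by blast

text \<open>Every option of a game must be accounted for in an equal game: it cannot be linked
  to that game, so the linking theorem leaves only these two possibilities.\<close>

lemma option_of_eq:
  assumes "G \<approx> H" "G' |\<in>| options G"
  obtains (reversible) G'' where "G'' |\<in>| options G'" "G'' \<approx> G"
    | (matched) H' where "H' |\<in>| options H" "G' \<approx> H'"
  using linked_if_no_option_eq[of G' H] option_not_linked[OF assms(2,1)] assms(1)
    game_eq_sym game_eq_trans by metis

lemma simplest_option_matched:
  assumes "simplest G" "G \<approx> H" "G' |\<in>| options G"
  obtains H' where "H' |\<in>| options H" "G' \<approx> H'"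
  using option_of_eq[OF assms(2,3)] assms(1,3) unfolding simplest_def reversible_def by metis

text \<open>By induction on \<open>X\<close>: if \<open>G + X\<close> is a \<open>\<P>\<close>-position, a winning move in \<open>H + X\<close>
  cannot lead to a sum \<open>H' + X\<close>, since \<open>X\<close> would link \<open>H'\<close> to \<open>G\<close>, nor can it be a move
  in \<open>X\<close>. The side conditions cover the remaining case that \<open>H + X\<close> is \<open>0\<close>, the only
  \<open>\<N>\<close>-position without a winning move.\<close>

lemma game_eq_if_not_linked:
  assumes G: "\<And>G'. G' |\<in>| options G \<Longrightarrow> \<not> linked G' H"
    and H: "\<And>H'. H' |\<in>| options H \<Longrightarrow> \<not> linked H' G"
    and zero: "G = 0 \<Longrightarrow> \<not> is_P H" "H = 0 \<Longrightarrow> \<not> is_P G"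
  shows "G \<approx> H"
proof -
  have "is_P (G + X) \<longleftrightarrow> is_P (H + X)" for X
  proof (induction X rule: game_induct)
    case (game X)
    have half: "is_P (L + X)"
      if K: "is_P (K + X)" and L: "\<And>L'. L' |\<in>| options L \<Longrightarrow> \<not> linked L' K"
        and IH: "\<And>X'. X' |\<in>| options X \<Longrightarrow> is_P (L + X') \<Longrightarrow> is_P (K + X')"
        and zero: "L = 0 \<Longrightarrow> \<not> is_P K" for K L
    proof (rule ccontr)
      assume neg: "\<not> is_P (L + X)"
      have "L + X \<noteq> 0"
      proof
        assume "L + X = 0"
        then have "options (L + X) = {||}" by simp
        then have "L = 0" "X = 0"
          using no_options_iff[of L] no_options_iff[of X] by (auto simp: options_add)
        then show False using K zero by simp
      qed
      with neg obtain Y where Y: "Y |\<in>| options (L + X)" "is_P Y" by (rule not_is_P_E)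
      from Y(1) show False
      proof (cases rule: option_addE)
        case (left L')
        then show ?thesis using L K Y(2) unfolding linked_def by blast
      next
        case (right X')
        then show ?thesis using IH Y(2) K is_P_D option_add_right by blast
      qed
    qed
    show ?case
      using half[of G H] half[of H G] game G H zero by blast
  qed
  then show ?thesis by (simp add: game_eq_def)
qed

lemma game_eq_if_options_eq:
  assumes "\<And>G'. G' |\<in>| options G \<Longrightarrow> \<exists>H'. H' |\<in>| options H \<and> G' \<approx> H'"
    and "\<And>H'. H' |\<in>| options H \<Longrightarrow> \<exists>G'. G' |\<in>| options G \<and> H' \<approx> G'"
  shows "G \<approx> H"
proof (rule game_eq_if_not_linked)
  have aux: "\<not> linked X K" if "L |\<in>| options K" "X \<approx> L" for X K L
    using that is_P_D option_add_left unfolding linked_def game_eq_def by blast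
  show "\<not> linked G' H" if "G' |\<in>| options G" for G' using assms(1)[OF that] aux by blast
  show "\<not> linked H' G" if "H' |\<in>| options H" for H' using assms(2)[OF that] aux by blast
  show "\<not> is_P H" if "G = 0"
    using assms(2) that no_options_iff[of H] by auto
  show "\<not> is_P G" if "H = 0"
    using assms(1) that no_options_iff[of G] by auto
qed

section \<open>Sums equal to zero\<close>

lemma options_one_plus_one: "options (1 + 1) = {|1 :: game|}"
  by (auto simp: options_add)

lemma one_plus_one: "1 + 1 \<approx> (0 :: game)"
proof (rule game_eq_if_not_linked)
  show "\<not> linked G' 0" if "G' |\<in>| options (1 + 1)" for G'
    using that is_P_D[of "1 + _" "0 + _"] option_add_left[of 0 1]
    by (auto simp: options_one_plus_one linked_def)
  show "\<not> is_P (1 + 1 :: game)"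
    using is_P_D[of "1 + 1" 1] by (auto simp: options_one_plus_one)
qed auto

lemma add_one_one: "G + 1 + 1 \<approx> G"
  using game_eq_add_left[OF one_plus_one, of G] by (simp add: add.assoc)

lemma add_one_cancel: "G + 1 \<approx> H + 1 \<Longrightarrow> G \<approx> H"
  using game_eq_add_right[of "G + 1" "H + 1" 1] add_one_one game_eq_sym game_eq_trans by blast

text \<open>Every option of a sum equal to \<open>0\<close> has to be reversible. A reversal within one
  summand leaves a smaller sum equal to \<open>0\<close>, in which the other summand is \<open>0\<close> or
  \<open>1\<close> by induction, and hence so is \<open>X\<close>. Otherwise the reversals pair options of \<open>X\<close> with
  options of \<open>Y\<close>, which inductively are \<open>0\<close> or \<open>1\<close>. If neither \<open>X\<close> nor \<open>Y\<close>
  is \<open>0\<close> or \<open>1\<close>, both \<open>X\<close> and \<open>Y\<close> would equal the nim-heap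
  of size two, two copies of which form a \<open>\<P>\<close>-position.\<close>

lemma part_of_zero: "X + Y \<approx> 0 \<Longrightarrow> X \<approx> 0 \<or> X \<approx> 1"
proof (induction "size X + size Y" arbitrary: X Y rule: less_induct)
  case less
  let ?U = "\<lambda>Z. Z \<approx> 0 \<or> Z \<approx> (1 :: game)"
  have other: "?U K" if "K + L \<approx> 0" "?U L" for K L
    using that(2)
  proof
    assume "L \<approx> 0"
    then have "K + L \<approx> K" using game_eq_add_left[of L 0 K] by simp
    then show ?thesis using that(1) game_eq_sym game_eq_trans by blast
  next
    assume "L \<approx> 1"
    then have "K + 1 \<approx> 1 + 1"
      using that(1) game_eq_add_left[of 1 L K] one_plus_one game_eq_sym game_eq_trans by blast
    then show ?thesis using add_one_cancel by blast
  qed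
  have small: "?U K" if "K + L \<approx> 0" "size K + size L < size X + size Y" for K L
    using less.hyps[OF that(2,1)] .
  show ?case
  proof (rule ccontr)
    assume X: "\<not> ?U X"
    then have Y: "\<not> ?U Y" using other less.prems by blast
    have sym: "L + K \<approx> 0" if "K + L \<approx> 0" for K L using that by (simp add: add.commute)
    have options_unit: "?U K'"
      if K': "K' |\<in>| options K" and KL: "K + L \<approx> 0" "\<not> ?U L"
        and size: "size K + size L = size X + size Y" for K L K'
    proof -
      have "K' + L |\<in>| options (K + L)" using K' by (rule option_add_left)
      then obtain Z where Z: "Z |\<in>| options (K' + L)" "Z \<approx> K + L"
        using option_of_eq[OF KL(1)] by auto
      then have "Z \<approx> 0" using KL(1) game_eq_trans by blast
      from Z(1) show ?thesis
      proof (cases rule: option_addE)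
        case (left K'')
        then have "?U L"
          using small[of L K''] sym[of K'' L] \<open>Z \<approx> 0\<close> size
            size_option[OF left(1)] size_option[OF K'] by simp
        then show ?thesis using KL(2) by blast
      next
        case (right L')
        then show ?thesis
          using small[of K' L'] \<open>Z \<approx> 0\<close> size size_option[OF right(1)] size_option[OF K'] by simp
      qed
    qed
    have X': "?U X'" if "X' |\<in>| options X" for X'
      using options_unit[OF that less.prems Y] by simp
    have Y': "?U Y'" if "Y' |\<in>| options Y" for Y'
      using options_unit[OF that sym[OF less.prems] X] by simp
    \<comment> \<open>Options all equal to \<open>0\<close> would give \<open>K = 1\<close>, options all equal to \<open>1\<close> would
      give \<open>K = 1 + 1 = 0\<close>.\<close>
    have both: "(\<exists>A. A |\<in>| options K \<and> A \<approx> 0) \<and> (\<exists>A. A |\<in>| options K \<and> A \<approx> 1)"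
      if K: "\<not> ?U K" and K': "\<And>K'. K' |\<in>| options K \<Longrightarrow> ?U K'" for K
    proof (rule ccontr)
      obtain A where A: "A |\<in>| options K"
        using K no_options_iff[of K] game_eq_refl[of 0] by auto
      assume "\<not> ?thesis"
      then consider "\<And>A. A |\<in>| options K \<Longrightarrow> A \<approx> 0" | "\<And>A. A |\<in>| options K \<Longrightarrow> A \<approx> 1"
        using K' by blast
      then show False
      proof cases
        case 1
        then have "K \<approx> 1" using A by (intro game_eq_if_options_eq) (auto intro: game_eq_sym)
        then show ?thesis using K by blast
      next
        case 2
        then have "K \<approx> 1 + 1"
          using A by (intro game_eq_if_options_eq)
            (auto simp: options_one_plus_one intro: game_eq_sym)
        then show ?thesis using K one_plus_one game_eq_trans by blast
      qed
    qed
    have N: "\<not> is_P (K' + L)" if K': "?U K'"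
      and L: "(\<exists>A. A |\<in>| options L \<and> A \<approx> 0) \<and> (\<exists>A. A |\<in>| options L \<and> A \<approx> 1)" for K' L
    proof -
      obtain A where A: "A |\<in>| options L" "K' + A \<approx> 1"
      proof (cases "K' \<approx> 0")
        case True
        obtain A where "A |\<in>| options L" "A \<approx> 1" using L by blast
        then show ?thesis using that game_eq_add[of K' 0 A 1] True by simp
      next
        case False
        obtain A where "A |\<in>| options L" "A \<approx> 0" using L by blast
        then show ?thesis using that game_eq_add[of K' 1 A 0] False K' by simp
      qed
      then have "is_P (K' + A)" using game_eq_is_P[of "K' + A" 1] by simp
      then show ?thesis using is_P_D option_add_right[OF A(1)] by blast
    qed
    note bX = both[OF X X'] and bY = both[OF Y Y']
    obtain A where "A |\<in>| options X" using bX by blast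
    then have "is_P (X + Y)"
    proof (rule is_P_I[OF option_add_left])
      fix Z assume "Z |\<in>| options (X + Y)"
      then show "\<not> is_P Z"
      proof (cases rule: option_addE)
        case (left X'')
        then show ?thesis using N[OF X' bY] by blast
      next
        case (right Y'')
        then show ?thesis using N[OF Y'[OF right(1)] bX] by (simp add: add.commute)
      qed
    qed
    then show False using game_eq_is_P[OF less.prems] by simp
  qed
qed

lemma copies_add: "(m + n) \<cdot> G = m \<cdot> G + n \<cdot> G"
  by (induction m) (simp_all add: add.assoc)

lemma copies_mult: "(m * n) \<cdot> G = m \<cdot> (n \<cdot> G)"
  by (induction m) (simp_all add: copies_add)

lemma copies_sum: "n \<cdot> (G + H) = n \<cdot> G + n \<cdot> H"
  by (induction n) (simp_all add: ac_simps)

lemma copies_zero [simp]: "n \<cdot> (0 :: game) = 0"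
  by (induction n) simp_all

lemma copies_eq: "G \<approx> H \<Longrightarrow> n \<cdot> G \<approx> n \<cdot> H"
  by (induction n) (auto intro: game_eq_add)

lemma copies_eq_zero:
  assumes "n \<cdot> G \<approx> 0" "n \<ge> 1"
  shows "G \<approx> 0 \<or> G \<approx> 1"
  using assms part_of_zero by (cases n) auto

lemma option_copies:
  assumes "X |\<in>| options (n \<cdot> G)"
  obtains m G' where "n = Suc m" "G' |\<in>| options G" "X = G' + m \<cdot> G"
proof -
  have "\<exists>m G'. n = Suc m \<and> G' |\<in>| options G \<and> X = G' + m \<cdot> G"
    using assms
  proof (induction n arbitrary: X)
    case (Suc n)
    then have "X |\<in>| options (G + n \<cdot> G)" by simp
    then show ?case
    proof (cases rule: option_addE)
      case (right Y)
      then obtain m G' where "n = Suc m" "G' |\<in>| options G" "Y = G' + m \<cdot> G"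
        using Suc.IH by blast
      then show ?thesis using right by (auto simp: ac_simps)
    qed auto
  qed simp
  then show ?thesis using that by blast
qed

section \<open>Approximate inverses and cancellation\<close>

definition option_closed :: "game set \<Rightarrow> bool" where
  "option_closed A \<longleftrightarrow> (\<forall>X\<in>A. \<forall>X'. X' |\<in>| options X \<longrightarrow> X' \<in> A)"

lemma option_closed_superset: "\<exists>A. finite A \<and> option_closed A \<and> G \<in> A"
proof (induction G rule: game_induct)
  case (game G)
  then obtain A where A: "\<And>G'. G' |\<in>| options G \<Longrightarrow>
      finite (A G') \<and> option_closed (A G') \<and> G' \<in> A G'"
    by metis
  then show ?case
    by (intro exI[of _ "insert G (\<Union>G'\<in>fset (options G). A G')"])
      (auto simp: option_closed_def)
qed

text \<open>By \<open>part_of_zero\<close>, only \<open>0\<close> and \<open>1\<close> have an exact inverse. For cancellation it suffices that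
  \<open>T + S\<close> cannot be told from \<open>0\<close> by a given finite set of games; closure under options
  makes this condition accessible to induction.\<close>

definition approx_invertible :: "game \<Rightarrow> bool" where
  "approx_invertible T \<longleftrightarrow> (\<forall>A. finite A \<longrightarrow> option_closed A \<longrightarrow>
     (\<exists>S. \<forall>X\<in>A. is_P (T + S + X) \<longleftrightarrow> is_P X))"

lemma approx_inverseE:
  assumes "approx_invertible T" "finite A" "option_closed A"
  obtains S where "\<forall>X\<in>A. is_P (T + S + X) \<longleftrightarrow> is_P X"
  using assms by (auto simp: approx_invertible_def)

lemma approx_invertible_cancel:
  assumes "approx_invertible T" "T + G \<approx> T + H"
  shows "G \<approx> H"
  unfolding game_eq_def
proof
  fix X
  obtain A where A: "finite A" "option_closed A" "G + X \<in> A"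
    using option_closed_superset by blast
  obtain B where B: "finite B" "option_closed B" "H + X \<in> B"
    using option_closed_superset by blast
  have "option_closed (A \<union> B)" using A(2) B(2) by (auto simp: option_closed_def)
  then obtain S where S: "\<And>Y. Y \<in> A \<union> B \<Longrightarrow> is_P (T + S + Y) \<longleftrightarrow> is_P Y"
    using approx_inverseE[OF assms(1)] A(1) B(1) by (metis finite_UnI)
  have "is_P (T + G + (S + X)) \<longleftrightarrow> is_P (T + H + (S + X))"
    using assms(2) by (simp add: game_eq_def)
  then show "is_P (G + X) \<longleftrightarrow> is_P (H + X)"
    using S[of "G + X"] S[of "H + X"] A(3) B(3) by (simp add: ac_simps)
qed

text \<open>Splitting off \<open>X\<close> again and again stays in a finite set, so it returns to some \<open>b\<close> after
  \<open>k\<close> steps. Then \<open>b = b + k \<cdot> X\<close>, and cancelling \<open>b\<close> leaves \<open>k \<cdot> X = 0\<close>.\<close>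

lemma shift_invariant_finite:
  assumes fin: "finite A" and a: "a \<in> A"
    and shift: "\<And>a. a \<in> A \<Longrightarrow> \<exists>b\<in>A. a \<approx> b + X"
    and cancel: "\<And>a. a \<in> A \<Longrightarrow> approx_invertible a"
  shows "X \<approx> 0 \<or> X \<approx> 1"
proof -
  obtain f where f: "\<And>a. a \<in> A \<Longrightarrow> f a \<in> A \<and> a \<approx> f a + X" using shift by metis
  have orbit: "(f ^^ i) b \<in> A \<and> b \<approx> (f ^^ i) b + i \<cdot> X" if b: "b \<in> A" for i b
  proof (induction i)
    case (Suc i)
    then have "(f ^^ i) b + i \<cdot> X \<approx> f ((f ^^ i) b) + X + i \<cdot> X"
      using f game_eq_add_right by blast
    then show ?case using Suc f game_eq_trans by (auto simp: add.assoc)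
  qed (use b in simp)
  have "\<not> inj (\<lambda>i. (f ^^ i) a)"
  proof
    assume "inj (\<lambda>i. (f ^^ i) a)"
    then have "infinite (range (\<lambda>i. (f ^^ i) a))" by (simp add: finite_image_iff)
    moreover have "range (\<lambda>i. (f ^^ i) a) \<subseteq> A" using orbit a by blast
    ultimately show False using fin finite_subset by blast
  qed
  then obtain i j where "(f ^^ i) a = (f ^^ j) a" "i < j"
    unfolding inj_def by (metis nat_neq_iff)
  moreover define k where "k = j - i"
  ultimately have k: "k \<ge> 1" and fix_point: "(f ^^ k) ((f ^^ i) a) = (f ^^ i) a"
    using funpow_add[of "j - i" i f] by (auto simp: comp_def fun_eq_iff)
  have b: "(f ^^ i) a \<in> A" using orbit a by blast
  then have "(f ^^ i) a + k \<cdot> X \<approx> (f ^^ i) a + 0"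
    using orbit[OF b, of k] fix_point game_eq_sym by simp
  then have "k \<cdot> X \<approx> 0" using approx_invertible_cancel[OF cancel[OF b]] by blast
  then show ?thesis using k by (rule copies_eq_zero)
qed

text \<open>An equality \<open>T + X = T\<close> makes each option of \<open>T\<close> an option of \<open>T + X\<close>. An option
  of the form \<open>T + X'\<close> would make \<open>T\<close> cancellable as a summand of a cancellable game;
  otherwise every option of \<open>T\<close> is the sum of an option of \<open>T\<close> and \<open>X\<close>, so that \<open>X\<close> is
  \<open>0\<close> or \<open>1\<close>. But \<open>T + 1\<close> differs from its option \<open>T\<close>.\<close>

lemma add_eq_self:
  assumes simple: "simplest T"
    and inv: "\<And>T'. T' |\<in>| options T \<Longrightarrow> approx_invertible T'"
    and eq: "T + X \<approx> T"
  shows "X \<approx> 0"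
proof (cases "T = 0")
  case True
  then show ?thesis using eq by simp
next
  case False
  show ?thesis
  proof (cases "\<exists>T' X'. T' |\<in>| options T \<and> T' \<approx> T + X'")
    case True
    then obtain T' X' where T': "T' |\<in>| options T" "T' \<approx> T + X'" by blast
    have "T' + X \<approx> T' + 0"
    proof -
      have "T' + X \<approx> T + X + X'"
        using game_eq_add_right[OF T'(2), of X] by (simp add: ac_simps)
      also have "T + X + X' \<approx> T + X'" using eq by (rule game_eq_add_right)
      also have "T + X' \<approx> T' + 0" using T'(2) game_eq_sym by simp
      finally show ?thesis .
    qed
    then show ?thesis using approx_invertible_cancel inv T'(1) by blast
  next
    case no_part: False
    obtain T0 where T0: "T0 \<in> fset (options T)" using False no_options_iff[of T] by auto
    have "\<exists>b\<in>fset (options T). a \<approx> b + X" if a: "a \<in> fset (options T)" for a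
    proof -
      obtain Y where Y: "Y |\<in>| options (T + X)" "a \<approx> Y"
        using simplest_option_matched[OF simple game_eq_sym[OF eq] a] .
      from Y(1) show ?thesis
        by (cases rule: option_addE) (use Y(2) a no_part in auto)
    qed
    then have "X \<approx> 0 \<or> X \<approx> 1"
      using shift_invariant_finite[OF finite_fset T0] inv by blast
    moreover have "\<not> X \<approx> 1"
    proof
      assume "X \<approx> 1"
      then have "T + 1 \<approx> T" using eq game_eq_add_left game_eq_sym game_eq_trans by blast
      moreover have "T |\<in>| options (T + 1)" using option_add_right[of 0 1 T] by simp
      ultimately show False using option_not_eq game_eq_sym by blast
    qed
    ultimately show ?thesis by blast
  qed
qed

text \<open>The options of the approximate inverse \<open>S\<close> of \<open>T\<close> are the winning replies that are
  needed: one that makes \<open>T + S\<close> an \<open>\<N>\<close>-position, and for every \<open>\<P>\<close>-position \<open>X\<close> in the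
  test set and every option \<open>T'\<close> one that answers the move from \<open>T + S + X\<close> to
  \<open>T' + S + X\<close>. They must not become winning moves in a sum \<open>T + S + Y\<close> with a
  \<open>\<P>\<close>-position \<open>Y\<close> in the test set. Separation provides such replies, as neither \<open>T\<close> nor
  \<open>T' + X\<close> equals a game \<open>T + Y\<close> of this kind: for \<open>T\<close> this is the preceding lemma, and
  for \<open>T' + X\<close> it follows with an approximate inverse \<open>S'\<close> of \<open>T'\<close>. Indeed, \<open>T' + X = T + Y\<close>
  would give \<open>X\<close> the outcome of \<open>T + S' + Y\<close>, which has the option \<open>T' + S' + Y\<close> with
  the outcome of \<open>Y\<close>.\<close>

lemma approx_invertible: "approx_invertible T"
proof (induction T rule: measure_induct_rule[where f = size])
  case (less T)
  show ?case
  proof (cases "simplest T")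
    case False
    then obtain T' T'' where T: "T' |\<in>| options T" "T'' |\<in>| options T'" "T'' \<approx> T"
      by (auto simp: simplest_def reversible_def)
    then have "approx_invertible T''" using less size_option by (meson less_trans)
    then show ?thesis
      using T(3) unfolding approx_invertible_def game_eq_def by (simp add: add.assoc)
  next
    case True
    have inv: "approx_invertible T'" if "T' |\<in>| options T" for T'
      using less size_option[OF that] by blast
    show ?thesis
      unfolding approx_invertible_def
    proof (intro allI impI)
      fix A :: "game set"
      assume fin: "finite A" and closed: "option_closed A"
      define P where "P = {X \<in> A. is_P X}"
      define replies where
        "replies = insert T ((\<lambda>(T', X). T' + X) ` (fset (options T) \<times> P))"
      have P_fin: "finite P" using fin by (simp add: P_def)
      have T_ne: "\<not> T \<approx> T + Y" if "Y \<in> P" for Y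
        using add_eq_self[OF True inv, of Y] that game_eq_is_P[of Y 0] game_eq_sym
        by (auto simp: P_def)
      have T'_ne: "\<not> T' + X \<approx> T + Y" if T': "T' |\<in>| options T" and "X \<in> P" "Y \<in> P" for T' X Y
      proof
        assume eq: "T' + X \<approx> T + Y"
        obtain S' where S': "\<forall>Z\<in>A. is_P (T' + S' + Z) \<longleftrightarrow> is_P Z"
          by (rule approx_inverseE[OF inv[OF T'] fin closed])
        have "is_P (T' + S' + X)" "is_P (T' + S' + Y)"
          using S' that(2,3) by (auto simp: P_def)
        then have "is_P (T' + X + S')" "is_P (T' + Y + S')"
          by (simp_all add: add.assoc add.commute[of S'])
        moreover from this(1) have "is_P (T + Y + S')"
          using eq unfolding game_eq_def by blast
        ultimately show False
          using is_P_D option_add_left[OF option_add_left[OF T']] by blast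
      qed
      have "\<exists>R. is_P (B + R) \<and> (\<forall>C\<in>(\<lambda>Y. T + Y) ` P. \<not> is_P (C + R))" if "B \<in> replies" for B
        by (rule separation) (use that P_fin T_ne T'_ne in \<open>auto simp: replies_def\<close>)
      then obtain r where r: "\<And>B. B \<in> replies \<Longrightarrow>
          is_P (B + r B) \<and> (\<forall>Y\<in>P. \<not> is_P (T + Y + r B))"
        by (metis image_eqI)
      have "finite (r ` replies)" using P_fin by (simp add: replies_def)
      then obtain S where S: "\<And>X. X |\<in>| options S \<longleftrightarrow> X \<in> r ` replies"
        using game_of_option_set[of "r ` replies"] by auto
      have T_reply: "T \<in> replies" by (simp add: replies_def)
      have "is_P (T + S + X) \<longleftrightarrow> is_P X" if "X \<in> A" for X
        using that
      proof (induction X rule: game_induct)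
        case (game X)
        have X': "is_P (T + S + X') \<longleftrightarrow> is_P X'" if "X' |\<in>| options X" for X'
          using game closed that unfolding option_closed_def by blast
        show ?case
        proof (cases "is_P X")
          case X_P: True
          then have X: "X \<in> P" using game.prems by (simp add: P_def)
          have "r T |\<in>| options S" using S T_reply by blast
          then have "is_P (T + S + X)"
          proof (rule is_P_I[OF option_add_left[OF option_add_right]])
            fix Z assume "Z |\<in>| options (T + S + X)"
            then show "\<not> is_P Z"
            proof (cases rule: option_addE)
              case (right X')
              then show ?thesis using X' X_P is_P_D by blast
            next
              case (left TS)
              from left(1) show ?thesis
              proof (cases rule: option_addE)
                case (left T')
                then have "T' + X \<in> replies" using X by (auto simp: replies_def)
                then have "is_P (T' + r (T' + X) + X)" "r (T' + X) |\<in>| options S"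
                  using r[of "T' + X"] S by (auto simp: ac_simps)
                then show ?thesis
                  using left \<open>Z = TS + X\<close> is_P_D option_add_left option_add_right by metis
              next
                case (right S')
                then obtain B where "B \<in> replies" "S' = r B" using S by blast
                then have "\<not> is_P (T + X + S')" using r X by blast
                then show ?thesis
                  using right(2) \<open>Z = TS + X\<close> by (simp add: add.assoc add.commute[of S'])
              qed
            qed
          qed
          then show ?thesis using X_P by simp
        next
          case X_N: False
          have "\<not> is_P (T + S + X)"
          proof (cases "X = 0")
            case True
            have "is_P (T + r T)" "r T |\<in>| options S" using r S T_reply by auto
            then show ?thesis using True is_P_D option_add_right by (metis add.right_neutral)
          next
            case False
            then obtain X' where "X' |\<in>| options X" "is_P X'" using X_N not_is_P_E by blast
            then show ?thesis using X' is_P_D option_add_right by blast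
          qed
          then show ?thesis using X_N by simp
        qed
      qed
      then show "\<exists>S. \<forall>X\<in>A. is_P (T + S + X) \<longleftrightarrow> is_P X" by blast
    qed
  qed
qed

lemma add_left_cancel_eq: "T + G \<approx> T + H \<Longrightarrow> G \<approx> H"
  using approx_invertible approx_invertible_cancel by blast

lemma add_right_cancel_eq: "G + T \<approx> H + T \<Longrightarrow> G \<approx> H"
  using add_left_cancel_eq[of T G H] by (simp add: add.commute)

section \<open>Parity\<close>

lemma even_game_cong: "G \<approx> H \<Longrightarrow> even_game G \<Longrightarrow> even_game H"
  unfolding even_game_def simplest_form_of_def
  by (meson game_eq_add_right game_eq_sym game_eq_trans)

text \<open>The simplest form of \<open>G + 1\<close> has an option \<open>S'\<close> equal to \<open>G\<close>. An option of \<open>K\<close>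
  equal to \<open>G + 1\<close> would be matched by an option of \<open>S'\<close>, making \<open>S'\<close> reversible.\<close>

lemma even_simplest_no_option:
  assumes even: "even_game G" and K: "simplest K" "K \<approx> G" "K' |\<in>| options K"
  shows "\<not> K' \<approx> G + 1"
proof
  assume K': "K' \<approx> G + 1"
  obtain S S' where S: "simplest S" "S \<approx> G + 1" "S' |\<in>| options S" "G \<approx> S'"
    using even unfolding even_game_def simplest_form_of_def by blast
  obtain S'' where "S'' |\<in>| options S'" "K' \<approx> S''"
    using simplest_option_matched[OF K(1) game_eq_trans[OF K(2) S(4)] K(3)] .
  moreover from this have "S'' \<approx> S" using K' S(2) game_eq_sym game_eq_trans by blast
  ultimately show False using S(1,3) by (auto simp: simplest_def reversible_def)
qed

lemma even_add_one:
  "even_game (G + 1) \<longleftrightarrow> (\<exists>K. simplest_form_of K G \<and> (\<exists>K' |\<in>| options K. K' \<approx> G + 1))"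
proof -
  have "K \<approx> G + 1 + 1 \<longleftrightarrow> K \<approx> G" for K
    using add_one_one game_eq_sym game_eq_trans by blast
  then show ?thesis
    unfolding even_game_def simplest_form_of_def using game_eq_sym by blast
qed

lemma not_even_add_one: "even_game G \<Longrightarrow> \<not> even_game (G + 1)"
  using even_simplest_no_option unfolding even_add_one simplest_form_of_def by blast

lemma not_even_one: "\<not> even_game 1"
proof
  assume "even_game 1"
  moreover have "simplest_form_of 1 (0 + 1)"
    by (simp add: simplest_form_of_def simplest_def reversible_def)
  then have "even_game 0"
    unfolding even_game_def by (intro exI[of _ 1]) auto
  ultimately show False using not_even_add_one[of 0] by simp
qed

text \<open>If a simplest form \<open>K\<close> of \<open>G\<close> has no option equal to \<open>G + 1\<close>, then \<open>K + 1\<close>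
  has no reversible option. It is therefore a simplest form of \<open>G + 1\<close>, with the option
  \<open>K\<close>.\<close>

lemma even_or_even_add_one: "even_game G \<or> even_game (G + 1)"
proof (rule ccontr)
  assume neg: "\<not> ?thesis"
  obtain K where K: "simplest K" "K \<approx> G"
    using simplest_form_exists by (auto simp: simplest_form_of_def)
  have K1: "K + 1 \<approx> G + 1" using K(2) by (rule game_eq_add_right)
  have no_K': "\<not> K' \<approx> K + 1" if "K' |\<in>| options K" for K'
    using neg that K K1 game_eq_trans unfolding even_add_one simplest_form_of_def by blast
  have "\<not> reversible (K + 1) Z" for Z
  proof
    assume "reversible (K + 1) Z"
    then obtain Z' where Z: "Z |\<in>| options (K + 1)" "Z' |\<in>| options Z" "Z' \<approx> K + 1"
      by (auto simp: reversible_def)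
    from Z(1) show False
    proof (cases rule: option_addE)
      case (left K')
      from Z(2) have "Z' |\<in>| options (K' + 1)" using left by simp
      then show ?thesis
      proof (cases rule: option_addE)
        case (left K'')
        then have "K'' \<approx> K" using Z(3) add_one_cancel by blast
        then show ?thesis
          using \<open>K' |\<in>| options K\<close> left(1) K(1) by (auto simp: simplest_def reversible_def)
      next
        case right
        then show ?thesis using no_K' \<open>K' |\<in>| options K\<close> Z(3) by simp
      qed
    next
      case right
      then show ?thesis using no_K' Z by simp
    qed
  qed
  then have "simplest_form_of (K + 1) (G + 1)"
    using K1 by (simp add: simplest_form_of_def simplest_def)
  moreover have "K |\<in>| options (K + 1)" using option_add_right[of 0 1 K] by simp
  ultimately have "even_game G"
    unfolding even_game_def using K(2) game_eq_sym by blast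
  then show False using neg by blast
qed

text \<open>An odd \<open>G\<close> has \<open>G + 1\<close> among its own options, so the passage to the even game of the
  pair \<open>G\<close>, \<open>G + 1\<close> does not increase the size.\<close>

lemma even_representative:
  obtains K where "even_game K" "size K \<le> size G" "G \<approx> K \<or> G \<approx> K + 1"
proof (cases "even_game G")
  case True
  then show ?thesis using that by simp
next
  case False
  then have even: "even_game (G + 1)" using even_or_even_add_one by blast
  then obtain S S' where S: "simplest S" "S \<approx> G" "S' |\<in>| options S" "S' \<approx> G + 1"
    unfolding even_add_one simplest_form_of_def by blast
  obtain K where K: "K |\<in>| options G" "S' \<approx> K"
    using simplest_option_matched[OF S(1-3)] .
  have K1: "K \<approx> G + 1" using K(2) S(4) game_eq_sym game_eq_trans by blast
  then have "K + 1 \<approx> G" using game_eq_add_right add_one_one game_eq_trans by blast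
  then show ?thesis
    using that[of K] even even_game_cong[OF game_eq_sym[OF K1]] size_option[OF K(1)] game_eq_sym
    by simp
qed

section \<open>Torsion\<close>

lemma double_copies_add_one: "(2 * n) \<cdot> (G + 1) \<approx> (2 * n) \<cdot> G"
proof -
  have "2 \<cdot> (G + 1) \<approx> 2 \<cdot> G"
    using game_eq_add_left[OF one_plus_one, of "G + G"] by (simp add: numeral_2_eq_2 ac_simps)
  then show ?thesis
    using copies_eq[of "2 \<cdot> (G + 1)" "2 \<cdot> G" n] by (simp add: copies_mult[symmetric] mult.commute)
qed

lemma copies_mult_eq: "n \<cdot> G \<approx> n \<cdot> H \<Longrightarrow> (k * n) \<cdot> G \<approx> (k * n) \<cdot> H"
  by (simp add: copies_mult copies_eq)

text \<open>Doubling \<open>n\<close> removes the summands \<open>1\<close>, so that torsion-freeness for even games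
  of bounded size describes the torsion of all games of that size.\<close>

lemma torsion_of_smaller:
  assumes even: "\<And>n K L. size K + size L < N \<Longrightarrow> n \<ge> 1 \<Longrightarrow> even_game K \<Longrightarrow> even_game L \<Longrightarrow>
      n \<cdot> K \<approx> n \<cdot> L \<Longrightarrow> K \<approx> L"
    and size: "size G + size H < N" and "n \<ge> 1" and eq: "n \<cdot> G \<approx> n \<cdot> H"
  shows "G \<approx> H \<or> G \<approx> H + 1"
proof -
  obtain K where K: "even_game K" "size K \<le> size G" "G \<approx> K \<or> G \<approx> K + 1"
    by (rule even_representative)
  obtain L where L: "even_game L" "size L \<le> size H" "H \<approx> L \<or> H \<approx> L + 1"
    by (rule even_representative)
  have K_eq: "(2 * n) \<cdot> G \<approx> (2 * n) \<cdot> K" and L_eq: "(2 * n) \<cdot> H \<approx> (2 * n) \<cdot> L"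
    using K(3) L(3) copies_eq double_copies_add_one game_eq_trans by blast+
  have "(2 * n) \<cdot> K \<approx> (2 * n) \<cdot> L"
    using K_eq L_eq copies_mult_eq[OF eq, of 2] game_eq_sym game_eq_trans by blast
  then have KL: "K \<approx> L" using even[of K L "2 * n"] K(1,2) L(1,2) size \<open>n \<ge> 1\<close> by simp
  then have KL1: "K + 1 \<approx> L + 1" by (rule game_eq_add_right)
  have "G \<approx> L \<or> G \<approx> L + 1" using K(3) KL KL1 game_eq_trans by blast
  moreover have "L \<approx> H \<and> L + 1 \<approx> H + 1 \<or> L + 1 \<approx> H \<and> L \<approx> H + 1"
    using L(3) game_eq_add_right[of H] add_one_one game_eq_sym game_eq_trans by metis
  ultimately show ?thesis using game_eq_trans by blast
qed

lemma even_torsion_free: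
  assumes "n \<ge> 1" "even_game G" "even_game H" "n \<cdot> G \<approx> n \<cdot> H"
  shows "G \<approx> H"
  using assms
proof (induction "size G + size H" arbitrary: n G H rule: less_induct)
  case less
  note even = less.prems(2,3) and eq = less.prems(4)
  obtain m where m: "n = Suc m" using less.prems(1) by (cases n) auto
  obtain S where S: "simplest S" "S \<approx> n \<cdot> G"
    using simplest_form_exists by (auto simp: simplest_form_of_def)
  show ?case
  proof (cases "S = 0")
    case True
    then have "n \<cdot> G \<approx> 0" "n \<cdot> H \<approx> 0" using S(2) eq game_eq_sym game_eq_trans by blast+
    then have "G \<approx> 0" "H \<approx> 0"
      using copies_eq_zero less.prems(1) even even_game_cong not_even_one by blast+
    then show ?thesis using game_eq_sym game_eq_trans by blast
  next
    case False
    then obtain S' where S': "S' |\<in>| options S" using no_options_iff[of S] by auto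
    have option: "\<exists>K'. K' |\<in>| options K \<and> S' \<approx> K' + m \<cdot> K" if K: "S \<approx> n \<cdot> K" for K
    proof -
      obtain Z where Z: "Z |\<in>| options (n \<cdot> K)" "S' \<approx> Z"
        using simplest_option_matched[OF S(1) K S'] .
      from Z(1) show ?thesis
        by (rule option_copies) (use Z(2) m in auto)
    qed
    obtain G' where G': "G' |\<in>| options G" "S' \<approx> G' + m \<cdot> G"
      using option[OF S(2)] by blast
    obtain H' where H': "H' |\<in>| options H" "S' \<approx> H' + m \<cdot> H"
      using option[OF game_eq_trans[OF S(2) eq]] by blast
    have opts: "G' + m \<cdot> G \<approx> H' + m \<cdot> H"
      using G'(2) H'(2) game_eq_sym game_eq_trans by blast
    have swap: "n \<cdot> (m \<cdot> K) = m \<cdot> (n \<cdot> K)" for K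
      by (metis copies_mult mult.commute)
    have "n \<cdot> G' + m \<cdot> (n \<cdot> G) \<approx> n \<cdot> H' + m \<cdot> (n \<cdot> H)"
      using copies_eq[OF opts, of n] by (simp only: copies_sum swap)
    also have "n \<cdot> H' + m \<cdot> (n \<cdot> H) \<approx> n \<cdot> H' + m \<cdot> (n \<cdot> G)"
      by (rule game_eq_add_left[OF copies_eq[OF game_eq_sym[OF eq]]])
    finally have "n \<cdot> G' \<approx> n \<cdot> H'" by (rule add_right_cancel_eq)
    then have G'_H': "G' \<approx> H' \<or> G' \<approx> H' + 1"
      using torsion_of_smaller[of "size G + size H" G' H' n, OF less.hyps] less.prems(1)
        size_option[OF G'(1)] size_option[OF H'(1)] by simp
    (* The equality G - H = G' - H', without subtraction. *)
    have cross: "G + H' \<approx> H + G'"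
    proof -
      have "G + H' + m \<cdot> H \<approx> G + (G' + m \<cdot> G)"
        using game_eq_add_left[OF game_eq_sym[OF opts], of G] by (simp add: add.assoc)
      also have "G + (G' + m \<cdot> G) = G' + n \<cdot> G" by (simp add: m ac_simps)
      also have "G' + n \<cdot> G \<approx> G' + n \<cdot> H" using eq by (rule game_eq_add_left)
      also have "G' + n \<cdot> H = H + G' + m \<cdot> H" by (simp add: m ac_simps)
      finally show ?thesis by (rule add_right_cancel_eq)
    qed
    from G'_H' show ?thesis
    proof
      assume "G' \<approx> H'"
      then have "G + H' \<approx> H + H'" using cross game_eq_add_left game_eq_trans by blast
      then show ?thesis by (rule add_right_cancel_eq)
    next
      assume "G' \<approx> H' + 1"
      then have "G + H' \<approx> H + (H' + 1)" using cross game_eq_add_left game_eq_trans by blast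
      then have "G + H' \<approx> (H + 1) + H'" by (simp add: ac_simps)
      then have "G \<approx> H + 1" by (rule add_right_cancel_eq)
      then show ?thesis using even even_game_cong not_even_add_one by blast
    qed
  qed
qed

theorem theorem6p8:
  fixes n :: nat and G H :: game
  assumes "n \<ge> 1"
    and "even_game G" and "even_game H"
    and "n \<cdot> G \<approx> n \<cdot> H"
  shows "G \<approx> H"
  using assms by (rule even_torsion_free)

end
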